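(* Let $\Phi\subset\mathbb{R}^3$ be a skew ruled $C^3$-surface, parametrized by $\boldsymbol{x}(u,v)=\boldsymbol{s}(u)+v\,\boldsymbol{e}(u)$, $(u,v)\in I\times\mathbb{R}$, where $\boldsymbol{s}$ is the striction line, $\boldsymbol{e}$ is a unit vector field along the rulings and $u$ is the arclength of the spherical curve $\boldsymbol{e}$. Let $k$, $\delta$ be its conical curvature and parameter of distribution, and let $w=\sqrt{v^2+\delta(u)^2}$. Suppose that the normal curvature $k_N$ along the orthogonal trajectories of the curves of constant striction distance (the curves $v=\text{constant}$) has the form $$k_N(u,v)=f(u)\,w^{n}\quad\text{for all }(u,v)\in I\times\mathbb{R},$$ for some integer $n\in\mathbb{Z}$ and some continuous function $f:I\to\mathbb{R}$. Then one of the following occurs: (a) $f=0$ (identically) and $\Phi$ is an orthoid ruled surface; (b) $n=-3$, $f(u)=\delta^2(u)\,k^{-1}(u)$ for all $u\in I$, and $\Phi$ is an Edlinger-surface.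
   Context: Setting. $I\subset\mathbb{R}$ is an open interval. A skew ruled $C^3$-surface $\Phi$ is a regular ruled surface of class $C^3$ without torsal rulings, parametrized on $I\times\mathbb{R}$ by $\boldsymbol{x}(u,v)=\boldsymbol{s}(u)+v\,\boldsymbol{e}(u)$ with $|\boldsymbol{e}|=1$, $|\boldsymbol{e}'|=1$ and $\langle\boldsymbol{s}',\boldsymbol{e}'\rangle=0$ on $I$ (so $\boldsymbol{s}$ is the striction line and $u$ is the arclength of $\boldsymbol{e}$); prime denotes $d/du$. Its invariants are: the conical curvature $k=(\boldsymbol{e},\boldsymbol{e}',\boldsymbol{e}'')$ and the parameter of distribution $\delta=(\boldsymbol{e},\boldsymbol{e}',\boldsymbol{s}')$ (both triple products), the striction $\sigma=\sphericalangle(\boldsymbol{e},\boldsymbol{s}')$ with $-\pi/2<\sigma\le\pi/2$ and $\operatorname{sign}\sigma=\operatorname{sign}\delta$, and $\lambda:=\cot\sigma$, so that $\boldsymbol{s}'=\delta\lambda\,\boldsymbol{e}+\delta\,\boldsymbol{e}\times\boldsymbol{e}'$. Skewness means $\delta(u)\neq0$ for all $u\in I$. The unit normal is $(\boldsymbol{x}_u\times\boldsymbol{x}_v)/|\boldsymbol{x}_u\times\boldsymbol{x}_v|$. The normal curvature at $(u,v)$ in direction $du:dv$ is $$k_N=\frac1w\cdot\frac{-[kv^2+\delta' v+\delta^2(k-\lambda)]\,du^2+2\delta\,du\,dv}{[v^2+\delta^2(\lambda^2+1)]\,du^2+2\delta\lambda\,du\,dv+dv^2}.$$ The orthogonal trajectories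 of the curves $v=\text{constant}$ are determined by $[v^2+\delta^2(\lambda^2+1)]\,du+\delta\lambda\,dv=0$. An Edlinger-surface is a skew ruled surface whose osculating quadrics are rotational hyperboloids; a known necessary and sufficient condition, to be used as the definition, is $\delta'=0$ and $k\lambda+1=0$ on $I$. A ruled surface is orthoid if its rulings are perpendicular to the striction line, i.e. $\lambda=0$ on $I$. *)

theory Defs
  imports "HOL-Analysis.Analysis"
begin

unbundle cross3_syntax

type_synonym curve = "real \<Rightarrow> real ^ 3"
type_synonym surface = "real \<Rightarrow> real \<Rightarrow> real ^ 3"

definition D :: "curve \<Rightarrow> curve" where
  "D c = (\<lambda>u. vector_derivative c (at u))"

text \<open>Class \<open>C\<^sup>m\<close> on an open set \<open>I\<close> of parameters.\<close>

primrec class_C :: "nat \<Rightarrow> real set \<Rightarrow> curve \<Rightarrow> bool" where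
  "class_C 0 I c \<longleftrightarrow> continuous_on I c"
| "class_C (Suc m) I c \<longleftrightarrow> (\<forall>u\<in>I. c differentiable at u) \<and> class_C m I (D c)"

definition partial_u :: "surface \<Rightarrow> surface" where
  "partial_u x = (\<lambda>u v. vector_derivative (\<lambda>t. x t v) (at u))"

definition partial_v :: "surface \<Rightarrow> surface" where
  "partial_v x = (\<lambda>u v. vector_derivative (\<lambda>t. x u t) (at v))"

definition unit_normal :: "surface \<Rightarrow> surface" where
  "unit_normal x u v =
     (1 / norm (partial_u x u v \<times> partial_v x u v)) *\<^sub>R (partial_u x u v \<times> partial_v x u v)"

text \<open>Quotient of the second and first fundamental forms of \<open>x\<close> at \<open>(u, v)\<close>,
  evaluated on the direction \<open>du : dv = a : b\<close>.\<close>

definition normal_curvature :: "surface \<Rightarrow> real \<Rightarrow> real \<Rightarrow> real \<Rightarrow> real \<Rightarrow> real" where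
  "normal_curvature x u v a b =
     (  (partial_u (partial_u x) u v \<bullet> unit_normal x u v) * a\<^sup>2
      + 2 * (partial_v (partial_u x) u v \<bullet> unit_normal x u v) * a * b
      + (partial_v (partial_v x) u v \<bullet> unit_normal x u v) * b\<^sup>2)
   / (  (partial_u x u v \<bullet> partial_u x u v) * a\<^sup>2
      + 2 * (partial_u x u v \<bullet> partial_v x u v) * a * b
      + (partial_v x u v \<bullet> partial_v x u v) * b\<^sup>2)"

text \<open>The direction \<open>du : dv = a : b\<close> at \<open>(u, v)\<close> is tangent to the orthogonal trajectory
  of the parameter curves \<open>v = const\<close>, whose tangent vector is \<open>x\<^sub>u\<close>.\<close>

definition orth_traj_dir :: "surface \<Rightarrow> real \<Rightarrow> real \<Rightarrow> real \<Rightarrow> real \<Rightarrow> bool" where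
  "orth_traj_dir x u v a b \<longleftrightarrow>
     (a, b) \<noteq> (0, 0) \<and>
     orthogonal (partial_u x u v) (a *\<^sub>R partial_u x u v + b *\<^sub>R partial_v x u v)"

definition ruled :: "curve \<Rightarrow> curve \<Rightarrow> surface" where
  "ruled s e = (\<lambda>u v. s u + v *\<^sub>R e u)"

definition triple :: "real ^ 3 \<Rightarrow> real ^ 3 \<Rightarrow> real ^ 3 \<Rightarrow> real" where
  "triple a b c = a \<bullet> (b \<times> c)"

definition conical_curvature :: "curve \<Rightarrow> real \<Rightarrow> real" where
  "conical_curvature e u = triple (e u) (D e u) (D (D e) u)"

definition distribution :: "curve \<Rightarrow> curve \<Rightarrow> real \<Rightarrow> real" where
  "distribution s e u = triple (e u) (D e u) (D s u)"

text \<open>The striction is the angle between \<open>e\<close> and \<open>s'\<close> carrying the sign of the parameter of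
  distribution, so it lies in \<open>(-\<pi>, \<pi>) - {0}\<close> on a skew ruled surface. Only its cotangent
  matters, so no reduction modulo \<open>\<pi>\<close> to \<open>(-\<pi>/2, \<pi>/2]\<close> is made; the lemma
  \<open>striction_tangent\<close> below confirms the resulting formula for \<open>s'\<close>.\<close>

definition striction :: "curve \<Rightarrow> curve \<Rightarrow> real \<Rightarrow> real" where
  "striction s e u =
     sgn (distribution s e u) * arccos ((e u \<bullet> D s u) / (norm (e u) * norm (D s u)))"

definition cot_striction :: "curve \<Rightarrow> curve \<Rightarrow> real \<Rightarrow> real" where
  "cot_striction s e u = cot (striction s e u)"

text \<open>As \<open>s u = x u 0\<close> and \<open>e u = x u 1 - x u 0\<close>, the parametrization \<open>x = ruled s e\<close> is of
  class \<open>C\<^sup>3\<close> on \<open>I \<times> \<real>\<close> iff \<open>s\<close> and \<open>e\<close> are of class \<open>C\<^sup>3\<close> on \<open>I\<close>.\<close>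

definition skew_ruled_C3_surface :: "real set \<Rightarrow> curve \<Rightarrow> curve \<Rightarrow> bool" where
  "skew_ruled_C3_surface I s e \<longleftrightarrow>
     open I \<and> is_interval I \<and>
     class_C 3 I s \<and> class_C 3 I e \<and>
     (\<forall>u\<in>I. \<forall>v. partial_u (ruled s e) u v \<times> partial_v (ruled s e) u v \<noteq> 0) \<and>
     (\<forall>u\<in>I. norm (e u) = 1 \<and> norm (D e u) = 1 \<and> D s u \<bullet> D e u = 0) \<and>
     (\<forall>u\<in>I. distribution s e u \<noteq> 0)"

definition orthoid :: "real set \<Rightarrow> curve \<Rightarrow> curve \<Rightarrow> bool" where
  "orthoid I s e \<longleftrightarrow> (\<forall>u\<in>I. cot_striction s e u = 0)"

text \<open>The osculating quadrics are rotational hyperboloids iff this condition holds.\<close>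

definition edlinger :: "real set \<Rightarrow> curve \<Rightarrow> curve \<Rightarrow> bool" where
  "edlinger I s e \<longleftrightarrow> skew_ruled_C3_surface I s e \<and>
     (\<forall>u\<in>I. (distribution s e has_real_derivative 0) (at u) \<and>
            conical_curvature e u * cot_striction s e u + 1 = 0)"

lemma unit_orthogonal_unit_tangent:
  assumes I: "open I" "u \<in> I" and n: "\<forall>t\<in>I. norm (e t) = 1" and d: "e differentiable at u"
  shows "e u \<bullet> D e u = 0"
proof -
  have "(e has_vector_derivative D e u) (at u)"
    using d by (simp add: D_def vector_derivative_works[symmetric])
  then have "((\<lambda>t. e t \<bullet> e t) has_derivative
      (\<lambda>h. e u \<bullet> (h *\<^sub>R D e u) + (h *\<^sub>R D e u) \<bullet> e u)) (at u)"
    unfolding has_vector_derivative_def by (intro has_derivative_inner)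
  moreover have "((\<lambda>t. e t \<bullet> e t) has_derivative (\<lambda>h. 0)) (at u)"
    by (rule has_derivative_transform_within_open[OF has_derivative_const[of 1] I])
       (use n in \<open>simp add: dot_square_norm\<close>)
  ultimately have "(\<lambda>h. e u \<bullet> (h *\<^sub>R D e u) + (h *\<^sub>R D e u) \<bullet> e u) = (\<lambda>h. 0)"
    by (rule has_derivative_unique)
  from fun_cong[OF this, of 1] show ?thesis by (simp add: inner_commute)
qed

lemma frame_expansion:
  fixes a b y :: "real ^ 3"
  assumes "a \<bullet> a = 1" "b \<bullet> b = 1" "a \<bullet> b = 0"
  shows "y = (y \<bullet> a) *\<^sub>R a + (y \<bullet> b) *\<^sub>R b + (y \<bullet> (a \<times> b)) *\<^sub>R (a \<times> b)"
proof -
  let ?r = "y - (y \<bullet> a) *\<^sub>R a - (y \<bullet> b) *\<^sub>R b"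
  have oa: "a \<bullet> ?r = 0" and ob: "b \<bullet> ?r = 0"
    using assms by (simp_all add: inner_diff_right inner_commute)
  have "(a \<times> b) \<times> (?r \<times> (a \<times> b)) = ((a \<times> b) \<bullet> (a \<times> b)) *\<^sub>R ?r - ((a \<times> b) \<bullet> ?r) *\<^sub>R (a \<times> b)"
    by (rule Lagrange)
  moreover have "?r \<times> (a \<times> b) = 0"
    unfolding Lagrange using oa ob by (metis diff_self inner_commute scaleR_zero_left)
  moreover have "(a \<times> b) \<bullet> (a \<times> b) = 1"
    using assms norm_cross_dot[of a b] by (simp add: power_mult_distrib power2_norm_eq_inner)
  moreover have "(a \<times> b) \<bullet> ?r = y \<bullet> (a \<times> b)"
    by (simp add: inner_diff_right dot_cross_self inner_commute[of y])
  ultimately have "?r = (y \<bullet> (a \<times> b)) *\<^sub>R (a \<times> b)" by simp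
  then show ?thesis by (simp add: diff_eq_eq add_ac)
qed

lemma striction_tangent:
  assumes S: "skew_ruled_C3_surface I s e" and u: "u \<in> I"
  shows "D s u = (distribution s e u * cot_striction s e u) *\<^sub>R e u
               + distribution s e u *\<^sub>R (e u \<times> D e u)"
proof -
  let ?d = "distribution s e u" and ?t = "D s u \<bullet> e u" and ?z = "e u \<times> D e u"
  have f: "norm (e u) = 1" "norm (D e u) = 1" "D s u \<bullet> D e u = 0" "?d \<noteq> 0"
    using S u by (auto simp: skew_ruled_C3_surface_def)
  have ort: "e u \<bullet> D e u = 0"
    by (rule unit_orthogonal_unit_tangent[of I])
       (use S u in \<open>auto simp: skew_ruled_C3_surface_def eval_nat_numeral\<close>)
  have dz: "?d = D s u \<bullet> ?z"
    unfolding distribution_def triple_def by (metis cross_triple inner_commute)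
  have ee: "e u \<bullet> e u = 1" "D e u \<bullet> D e u = 1" using f by (simp_all add: dot_square_norm)
  have s: "D s u = ?t *\<^sub>R e u + ?d *\<^sub>R ?z"
    using frame_expansion[OF ee ort, of "D s u"]
    unfolding f(3) dz[symmetric] scaleR_zero_left add_0_right .
  have "D s u \<bullet> D s u = ?t * ?t + ?d * ?d"
    using arg_cong[OF s, of "\<lambda>y. D s u \<bullet> y"]
    unfolding inner_add_right inner_scaleR_right dz[symmetric] .
  then have N: "norm (D s u) = sqrt (?t\<^sup>2 + ?d\<^sup>2)"
    by (simp add: norm_eq_sqrt_inner power2_eq_square)
  define r where "r = sqrt (?t\<^sup>2 + ?d\<^sup>2)"
  have r: "r > 0" "r\<^sup>2 = ?t\<^sup>2 + ?d\<^sup>2"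
    using f(4) by (auto simp: r_def add_nonneg_pos)
  have "?t\<^sup>2 \<le> r\<^sup>2" using r by simp
  then have "\<bar>?t\<bar> \<le> r" using r(1) by (simp flip: abs_le_square_iff)
  then have b: "-1 \<le> ?t / r" "?t / r \<le> 1" using r(1) by (simp_all add: field_simps abs_le_iff)
  have st: "striction s e u = sgn ?d * arccos (?t / r)"
    using f N by (simp add: striction_def r_def inner_commute)
  have "sin (arccos (?t / r)) = sqrt (1 - (?t / r)\<^sup>2)"
    by (rule sin_arccos[OF b])
  also have "1 - (?t / r)\<^sup>2 = (r\<^sup>2 - ?t\<^sup>2) / r\<^sup>2"
    using r(1) by (simp add: power_divide diff_divide_distrib)
  also have "\<dots> = (?d / r)\<^sup>2"
    using r(2) by (simp add: power_divide)
  finally have sn: "sin (arccos (?t / r)) = \<bar>?d\<bar> / r" using r by simp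
  have cs: "cos (arccos (?t / r)) = ?t / r"
    by (rule cos_arccos[OF b])
  have "cot_striction s e u = ?t / ?d"
  proof (cases "?d > 0")
    case True
    then show ?thesis using r sn cs by (simp add: cot_striction_def st cot_def)
  next
    case False
    then have "?d < 0" using f(4) by linarith
    then show ?thesis using r sn cs by (simp add: cot_striction_def st cot_def)
  qed
  then have "?d * cot_striction s e u = ?t" using f(4) by simp
  then show ?thesis using s by (simp only:)
qed

unbundle no cross3_syntax

end

theory Submission
  imports Defs
begin

text \<open>
  In the frame \<open>e, e', e \<times> e'\<close> the hypothesis becomes, with \<open>w\<^sup>2 = v\<^sup>2 + \<delta>\<^sup>2\<close>,
  \<open>-\<delta>\<^sup>2\<lambda> ((k\<lambda> + 2) v\<^sup>2 + \<lambda>\<delta>' v + \<delta>\<^sup>2(k\<lambda> + \<lambda>\<^sup>2 + 2)) = f w\<^bsup>n+3\<^esup> (v\<^sup>2 + \<delta>\<^sup>2(\<lambda>\<^sup>2 + 1))\<close>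
  for all \<open>v\<close>. If \<open>\<lambda> \<noteq> 0\<close>, the part odd in \<open>v\<close> gives \<open>\<delta>' = 0\<close>; what remains, multiplied by a power
  of \<open>w\<close> if \<open>n < -3\<close>, is an identity of polynomials in \<open>w\<close>, and its value at \<open>w = 0\<close> forces
  \<open>n = -3\<close>, whence \<open>k\<lambda> = -1\<close> and \<open>f k = \<delta>\<^sup>2\<close>. So at each \<open>u\<close> either \<open>f = \<lambda> = 0\<close> or \<open>f k = \<delta>\<^sup>2 \<noteq> 0\<close>;
  both conditions are closed, so one of them holds throughout the interval.
\<close>

unbundle cross3_syntax

section \<open>Polynomial identities and the algebra at a fixed parameter\<close>

lemma poly_eq_if_eq_at_top:
  fixes p q :: "real poly"
  assumes "\<And>x. x \<ge> a \<Longrightarrow> poly p x = poly q x"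
  shows "p = q"
proof (rule ccontr)
  assume "p \<noteq> q"
  then have "finite {x. poly (p - q) x = 0}"
    by (intro poly_roots_finite) simp
  moreover have "{a..} \<subseteq> {x. poly (p - q) x = 0}"
    using assms by auto
  ultimately show False
    using infinite_Ici[of a] finite_subset by blast
qed

text \<open>Since \<open>w\<close> stands for a square root that is at least
  \<open>\<bar>d\<bar>\<close>, the identity is given only on a half-line. Agreement there makes
  polynomials equal, so they may be compared at 0, a value that \<open>w\<close> never
  takes.\<close>

lemma powi_quadratic_identity:
  fixes a b c r :: real and m :: int
  assumes id: "\<And>w. w \<ge> r \<Longrightarrow> c * w powi m * (w\<^sup>2 + b) = a * w\<^sup>2 + b"
    and r: "r > 0" and b: "b \<noteq> 0" and c: "c \<noteq> 0"
  shows "m = 0 \<and> c = 1 \<and> a = 1"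
proof -
  consider j where "m = int j" | j where "m = - int j" "j > 0"
    by (metis int_cases2 of_nat_0 neg_equal_0_iff_equal neq0_conv)
  then show ?thesis
  proof cases
    case 1
    have eq: "smult c (monom 1 j * [:b, 0, 1:]) = [:b, 0, a:]"
    proof (rule poly_eq_if_eq_at_top[of r])
      fix w assume "w \<ge> r"
      from id[OF this] show "poly (smult c (monom 1 j * [:b, 0, 1:])) w = poly [:b, 0, a:] w"
        by (simp add: 1 poly_monom algebra_simps power2_eq_square)
    qed
    \<comment> \<open>At 0 a positive power would kill the left side, while the right side is
      \<open>b\<close>. With \<open>j = 0\<close> the coefficients give \<open>c = 1\<close> and
      \<open>a = c\<close>.\<close>
    have "j = 0"
      using arg_cong[OF eq, of "\<lambda>p. poly p 0"] b by (cases j) (auto simp: poly_monom)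
    then show ?thesis
      using eq b 1 by (auto simp: monom_0)
  next
    case 2
    have "smult c [:b, 0, 1:] = monom 1 j * [:b, 0, a:]"
    proof (rule poly_eq_if_eq_at_top[of r])
      fix w assume w: "w \<ge> r"
      then have "w ^ j \<noteq> 0" using r by simp
      with id[OF w] show "poly (smult c [:b, 0, 1:]) w = poly (monom 1 j * [:b, 0, a:]) w"
        by (simp add: 2 poly_monom power_int_minus field_simps power2_eq_square)
    qed
    \<comment> \<open>Contradiction: at 0 the right side vanishes because \<open>j > 0\<close>, and
      the left side is \<open>c * b\<close>.\<close>
    from arg_cong[OF this, of "\<lambda>p. poly p 0"] show ?thesis
      using 2 b c by (auto simp: poly_monom)
  qed
qed

text \<open>The pointwise dichotomy: the reals stand for the invariants at one fixed parameter, with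
  \<open>d'\<close> for the derivative of \<delta> and \<open>l\<close> for \<lambda>.\<close>

lemma normal_curvature_identity_cases:
  fixes d d' k l f :: real
  assumes id: "\<And>v. - d\<^sup>2 * l * ((k * l + 2) * v\<^sup>2 + l * d' * v + d\<^sup>2 * (k * l + l\<^sup>2 + 2))
                 = f * sqrt (v\<^sup>2 + d\<^sup>2) powi (n + 3) * (v\<^sup>2 + d\<^sup>2 * (l\<^sup>2 + 1))"
    and d: "d \<noteq> 0"
  shows "(f = 0 \<and> l = 0) \<or> (n = -3 \<and> d' = 0 \<and> k * l + 1 = 0 \<and> f * k = d\<^sup>2)"
proof (cases "l = 0")
  case True
  have "d\<^sup>2 + 1 \<noteq> 0" by (metis add_pos_nonneg add.commute less_numeral_extra(1,3) zero_le_power2)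
  then have "f = 0" using id[of 0] d True by simp
  then show ?thesis using True by simp
next
  case l: False
  \<comment> \<open>The right side of \<open>id\<close> is even in \<open>v\<close>, so its values
    at 1 and -1 agree and the linear coefficient must vanish.\<close>
  have "- d\<^sup>2 * l * ((k * l + 2) * 1\<^sup>2 + l * d' * 1 + d\<^sup>2 * (k * l + l\<^sup>2 + 2))
      = - d\<^sup>2 * l * ((k * l + 2) * (- 1)\<^sup>2 + l * d' * (- 1) + d\<^sup>2 * (k * l + l\<^sup>2 + 2))"
    unfolding id by simp
  then have "d' = 0" using d l by simp
  define c where "c = - f / (d\<^sup>2 * l)"
  have f: "f = - c * d\<^sup>2 * l" using d l by (simp add: c_def)
  \<comment> \<open>Substituting \<open>v\<^sup>2 = w\<^sup>2 - d\<^sup>2\<close> and cancelling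
    \<open>- d\<^sup>2 * l\<close> leaves two quadratics with the same nonzero constant term
    \<open>d\<^sup>2 * l\<^sup>2\<close>.\<close>
  have id': "c * w powi (n + 3) * (w\<^sup>2 + d\<^sup>2 * l\<^sup>2) = (k * l + 2) * w\<^sup>2 + d\<^sup>2 * l\<^sup>2"
    if "w \<ge> \<bar>d\<bar>" for w
  proof -
    have w2: "d\<^sup>2 \<le> w\<^sup>2" using that by (simp add: abs_le_square_iff[symmetric])
    define v where "v = sqrt (w\<^sup>2 - d\<^sup>2)"
    have v: "v\<^sup>2 = w\<^sup>2 - d\<^sup>2" using w2 by (simp add: v_def)
    have sw: "sqrt (v\<^sup>2 + d\<^sup>2) = w" using that by (simp add: v)
    from id[of v, unfolded sw, unfolded v f]
    have "(- d\<^sup>2 * l) * ((k * l + 2) * w\<^sup>2 + d\<^sup>2 * l\<^sup>2)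
        = (- d\<^sup>2 * l) * (c * w powi (n + 3) * (w\<^sup>2 + d\<^sup>2 * l\<^sup>2))"
      by (simp add: \<open>d' = 0\<close> algebra_simps)
    then show ?thesis using d l by simp
  qed
  have "c \<noteq> 0"
  proof
    assume "c = 0"
    then have *: "(k * l + 2) * w\<^sup>2 + d\<^sup>2 * l\<^sup>2 = 0" if "w \<ge> \<bar>d\<bar>" for w using id'[OF that] by simp
    have "[:d\<^sup>2 * l\<^sup>2, 0, k * l + 2:] = 0"
      by (rule poly_eq_if_eq_at_top[of "\<bar>d\<bar>"]) (use * in \<open>simp add: algebra_simps power2_eq_square\<close>)
    then show False using d l by simp
  qed
  with powi_quadratic_identity[of "\<bar>d\<bar>" c "n + 3" "d\<^sup>2 * l\<^sup>2" "k * l + 2"] id' d l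
  have *: "n + 3 = 0" "c = 1" "k * l + 2 = 1" by auto
  then have "k * l = -1" by simp
  then have "f * k = d\<^sup>2" using f *(2) 
    by (simp add: mult.assoc mult.left_commute[of l] mult.commute[of l])
  then show ?thesis using * \<open>d' = 0\<close> by simp
qed

section \<open>Derivatives of the ruled parametrization and of \<delta>\<close>

lemma D_works: "c differentiable at u \<Longrightarrow> (c has_vector_derivative D c u) (at u)"
  by (simp add: D_def vector_derivative_works[symmetric])

text \<open>Differentiating the relations \<open>e t \<bullet> D e t = 0\<close> and
  \<open>D s t \<bullet> D e t = 0\<close> yields the frame components of second
  derivatives.\<close>

lemma inner_constant_derivative:
  fixes f g :: curve
  assumes I: "open I" "u \<in> I" and const: "\<And>t. t \<in> I \<Longrightarrow> f t \<bullet> g t = c"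
    and d: "f differentiable at u" "g differentiable at u"
  shows "f u \<bullet> D g u + D f u \<bullet> g u = 0"
proof -
  have "((\<lambda>t. f t \<bullet> g t) has_derivative (\<lambda>h. f u \<bullet> (h *\<^sub>R D g u) + (h *\<^sub>R D f u) \<bullet> g u)) (at u)"
    using d[THEN D_works] unfolding has_vector_derivative_def by (intro has_derivative_inner)
  moreover have "((\<lambda>t. f t \<bullet> g t) has_derivative (\<lambda>h. 0)) (at u)"
    by (rule has_derivative_transform_within_open[OF has_derivative_const[of c] I])
       (use const in simp)
  ultimately have "(\<lambda>h. f u \<bullet> (h *\<^sub>R D g u) + (h *\<^sub>R D f u) \<bullet> g u) = (\<lambda>h. 0)"
    by (rule has_derivative_unique)
  from fun_cong[OF this, of 1] show ?thesis by simp
qed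

lemma partial_v_ruled: "partial_v (ruled s e) u v = e u"
  unfolding partial_v_def ruled_def
  by (rule vector_derivative_at) (auto intro!: derivative_eq_intros)

lemma partial_v_partial_v_ruled: "partial_v (partial_v (ruled s e)) u v = 0"
proof -
  have "partial_v (ruled s e) = (\<lambda>u v. e u)" by (intro ext) (rule partial_v_ruled)
  then show ?thesis by (simp add: partial_v_def)
qed

lemma partial_u_ruled:
  assumes "s differentiable at u" "e differentiable at u"
  shows "partial_u (ruled s e) u v = D s u + v *\<^sub>R D e u"
  unfolding partial_u_def ruled_def
  by (rule vector_derivative_at) (auto intro!: derivative_eq_intros D_works assms)

lemma partial_v_partial_u_ruled:
  assumes "s differentiable at u" "e differentiable at u"
  shows "partial_v (partial_u (ruled s e)) u v = D e u"
  unfolding partial_v_def partial_u_ruled[OF assms]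
  by (rule vector_derivative_at) (auto intro!: derivative_eq_intros)

lemma partial_u_partial_u_ruled:
  assumes I: "open I" "u \<in> I"
    and "\<And>t. t \<in> I \<Longrightarrow> s differentiable at t" "\<And>t. t \<in> I \<Longrightarrow> e differentiable at t"
    and "D s differentiable at u" "D e differentiable at u"
  shows "partial_u (partial_u (ruled s e)) u v = D (D s) u + v *\<^sub>R D (D e) u"
proof -
  have "((\<lambda>t. D s t + v *\<^sub>R D e t) has_vector_derivative D (D s) u + v *\<^sub>R D (D e) u) (at u)"
    by (auto intro!: derivative_eq_intros D_works assms)
  \<comment> \<open>The formula for the first partial derivative is known only on \<open>I\<close>,
    hence the transfer within an open set.\<close>
  then have "((\<lambda>t. partial_u (ruled s e) t v) has_vector_derivative D (D s) u + v *\<^sub>R D (D e) u) (at u)"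
    by (rule has_vector_derivative_transform_within_open[OF _ I]) (simp add: partial_u_ruled assms)
  then show ?thesis
    unfolding partial_u_def[of "partial_u (ruled s e)"] by (rule vector_derivative_at)
qed

text \<open>Of the three terms of the product rule, the one containing
  \<open>D e u \<times> D e u\<close> vanishes.\<close>

lemma has_derivative_distribution:
  assumes "e differentiable at u" "D e differentiable at u" "D s differentiable at u"
  shows "(distribution s e has_real_derivative
           triple (e u) (D (D e) u) (D s u) + triple (e u) (D e u) (D (D s) u)) (at u)"
proof -
  have cr: "bounded_bilinear (\<times>)"
    by (rule bilinear_conv_bounded_bilinear[THEN iffD1, OF bilinear_cross])
  have "((\<lambda>t. (e t \<times> D e t)) has_vector_derivative (e u \<times> D (D e) u + D e u \<times> D e u)) (at u)"
    by (rule bounded_bilinear.has_vector_derivative[OF cr]) (intro D_works assms)+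
  moreover have assoc: "a \<bullet> (b \<times> c) = (a \<times> b) \<bullet> c" for a b c
    by (metis cross_triple inner_commute)
  ultimately show ?thesis
    unfolding has_real_derivative_iff_has_vector_derivative distribution_def[abs_def] triple_def
    using bounded_bilinear.has_vector_derivative[OF bounded_bilinear_inner _ D_works[OF assms(3)],
        of "\<lambda>t. e t \<times> D e t" "e u \<times> D (D e) u + D e u \<times> D e u"]
    by (simp add: assoc add.commute)
qed

section \<open>Normal curvature along the orthogonal trajectories\<close>

lemma skew_ruled_regularity:
  assumes "skew_ruled_C3_surface I s e" and "u \<in> I"
  shows "s differentiable at u" "e differentiable at u"
    "D s differentiable at u" "D e differentiable at u" "D (D e) differentiable at u"
  using assms by (auto simp: skew_ruled_C3_surface_def eval_nat_numeral)

text \<open>With first fundamental coefficients \<open>E\<close>, \<open>F\<close>,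
  \<open>G\<close>, the trajectory satisfies \<open>E * a + F * b = 0\<close>. The solution
  \<open>a = F\<close>, \<open>b = - E\<close> is nonzero for every \<lambda>, because
  \<open>E > 0\<close>.\<close>

lemma normal_curvature_orth_traj:
  assumes S: "skew_ruled_C3_surface I s e" and u: "u \<in> I"
    and "d = distribution s e u" and "k = conical_curvature e u" and "l = cot_striction s e u"
    and d': "(distribution s e has_real_derivative d') (at u)"
    and "a = d * l" and "b = - (v\<^sup>2 + d\<^sup>2 * (l\<^sup>2 + 1))"
  shows "orth_traj_dir (ruled s e) u v a b"
    and "normal_curvature (ruled s e) u v a b =
      - d\<^sup>2 * l * ((k * l + 2) * v\<^sup>2 + l * d' * v + d\<^sup>2 * (k * l + l\<^sup>2 + 2))
        / (sqrt (v\<^sup>2 + d\<^sup>2) ^ 3 * (v\<^sup>2 + d\<^sup>2 * (l\<^sup>2 + 1)))"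
proof -
  note reg = skew_ruled_regularity[OF S]
  \<comment> \<open>The orthonormal frame in which all derivatives are expanded.\<close>
  define p q z where "p = e u" and "q = D e u" and "z = p \<times> q"
  define s2 e2 where "s2 = D (D s) u" and "e2 = D (D e) u"
  define w where "w = sqrt (v\<^sup>2 + d\<^sup>2)"
  have I: "open I" and unit: "\<And>t. t \<in> I \<Longrightarrow> norm (e t) = 1" "\<And>t. t \<in> I \<Longrightarrow> norm (D e t) = 1"
    and str: "\<And>t. t \<in> I \<Longrightarrow> D s t \<bullet> D e t = 0" and d0: "d \<noteq> 0"
    using S u assms(3) by (auto simp: skew_ruled_C3_surface_def)
  have ort: "e t \<bullet> D e t = 0" if "t \<in> I" for t
    by (rule unit_orthogonal_unit_tangent[OF I that]) (use unit reg that in auto)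
  have pq: "p \<bullet> p = 1" "q \<bullet> q = 1" "p \<bullet> q = 0"
    using unit ort u by (simp_all add: p_def q_def dot_square_norm)
  have pz: "p \<bullet> z = 0" "q \<bullet> z = 0"
    by (simp_all add: z_def dot_cross_self)
  have zz: "z \<bullet> z = 1"
    using pq norm_cross_dot[of p q] by (simp add: z_def power_mult_distrib power2_norm_eq_inner)
  have zp: "z \<times> p = q" "q \<times> p = - z"
    using pq cross_skew[of z p] cross_skew[of q p] Lagrange[of p p q] by (simp_all add: z_def)
  have s1: "D s u = (d * l) *\<^sub>R p + d *\<^sub>R z"
    using striction_tangent[OF S u] assms(3,5) by (simp add: p_def q_def z_def)
  have e2p: "e2 \<bullet> p = - 1"
    using inner_constant_derivative[OF I u, of e "D e" 0] ort reg(2,4)[OF u] pq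
    by (simp add: p_def q_def e2_def inner_commute)
  have e2q: "e2 \<bullet> q = 0"
    using unit_orthogonal_unit_tangent[OF I u, of "D e"] unit(2) reg(4)[OF u]
    by (simp add: q_def e2_def inner_commute)
  have e2z: "e2 \<bullet> z = k"
    unfolding assms(4) conical_curvature_def triple_def e2_def p_def q_def z_def
    by (metis cross_triple inner_commute)
  have s2q: "s2 \<bullet> q = d * l - d * k"
    using inner_constant_derivative[OF I u, of "D s" "D e" 0] str reg(3,4)[OF u] e2p e2z
    by (simp add: s1 q_def e2_def s2_def inner_commute inner_add_left inner_add_right algebra_simps)
  \<comment> \<open>Both \<open>e2\<close> and \<open>D s u\<close> lie in the plane of
    \<open>p\<close> and \<open>z\<close>, so the three vectors are coplanar. Hence
    \<open>d'\<close> is just the \<open>z\<close>-component of \<open>s2\<close>.\<close>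
  have "triple (e u) (D (D e) u) (D s u) = 0"
  proof -
    have e2: "e2 = - p + k *\<^sub>R z"
      using frame_expansion[OF pq, of e2] e2p e2q e2z by (simp add: z_def)
    show ?thesis
      unfolding triple_def e2_def[symmetric] p_def[symmetric] s1 e2
      by (simp add: cross_add_left cross_add_right cross_mult_left cross_mult_right cross_refl
          Cross3.left_diff_distrib inner_diff_right inner_add_right dot_cross_self)
  qed
  moreover have "triple (e u) (D e u) (D (D s) u) = s2 \<bullet> z"
    unfolding triple_def s2_def p_def q_def z_def by (metis cross_triple inner_commute)
  ultimately have s2z: "s2 \<bullet> z = d'"
    using has_derivative_distribution[of e u s] reg[OF u] DERIV_unique[OF d'] by auto
  have xu: "partial_u (ruled s e) u v = (d * l) *\<^sub>R p + v *\<^sub>R q + d *\<^sub>R z"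
    using partial_u_ruled[of s u e] reg u by (simp add: s1 q_def)
  have xv: "partial_v (ruled s e) u v = p"
    by (simp add: partial_v_ruled p_def)
  have nv: "partial_u (ruled s e) u v \<times> partial_v (ruled s e) u v = d *\<^sub>R q - v *\<^sub>R z"
    by (simp add: xu xv cross_add_left cross_mult_left cross_refl zp)
  have w: "w > 0" "w\<^sup>2 = v\<^sup>2 + d\<^sup>2"
    using d0 by (simp_all add: w_def add_nonneg_pos)
  have "norm (d *\<^sub>R q - v *\<^sub>R z) = w"
    using pz(2) pq(2) zz
    by (simp add: norm_eq_sqrt_inner inner_diff_left inner_diff_right inner_commute w_def
        power2_eq_square)
  then have N: "unit_normal (ruled s e) u v = (1 / w) *\<^sub>R (d *\<^sub>R q - v *\<^sub>R z)"
    by (simp add: unit_normal_def nv)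
  have xuu: "partial_u (partial_u (ruled s e)) u v = s2 + v *\<^sub>R e2"
    unfolding s2_def e2_def by (rule partial_u_partial_u_ruled[OF I u]) (use reg u in auto)
  have xuv: "partial_v (partial_u (ruled s e)) u v = q"
    unfolding q_def by (rule partial_v_partial_u_ruled) (use reg u in auto)
  have L: "partial_u (partial_u (ruled s e)) u v \<bullet> unit_normal (ruled s e) u v
      = - (k * v\<^sup>2 + d' * v + d\<^sup>2 * (k - l)) / w"
    by (simp add: xuu N inner_add_left inner_diff_right s2q s2z e2q e2z)
       (simp add: algebra_simps power2_eq_square)
  have M: "partial_v (partial_u (ruled s e)) u v \<bullet> unit_normal (ruled s e) u v = d / w"
    by (simp add: xuv N inner_diff_right pq pz)
  have E: "partial_u (ruled s e) u v \<bullet> partial_u (ruled s e) u v = v\<^sup>2 + d\<^sup>2 * (l\<^sup>2 + 1)"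
    using pq pz zz
    by (simp add: xu inner_add_left inner_add_right inner_commute power2_eq_square algebra_simps)
  have F: "partial_u (ruled s e) u v \<bullet> partial_v (ruled s e) u v = d * l"
    using pq pz by (simp add: xu xv inner_add_left inner_commute[of q p] inner_commute[of z p])
  have G: "partial_v (ruled s e) u v \<bullet> partial_v (ruled s e) u v = 1"
    using pq by (simp add: xv)
  have E0: "v\<^sup>2 + d\<^sup>2 * (l\<^sup>2 + 1) > 0"
    using d0 by (simp add: add_nonneg_pos)
  show "orth_traj_dir (ruled s e) u v a b"
    using E0 by (simp add: orth_traj_dir_def orthogonal_def inner_add_right E F assms(7,8) algebra_simps)
  define Q where "Q = v\<^sup>2 + d\<^sup>2 * (l\<^sup>2 + 1)"
  have "normal_curvature (ruled s e) u v a b =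
      (- (k * v\<^sup>2 + d' * v + d\<^sup>2 * (k - l)) / w * a\<^sup>2 + 2 * (d / w) * a * b)
      / (Q * a\<^sup>2 + 2 * (d * l) * a * b + b\<^sup>2)"
    by (simp add: normal_curvature_def L M E F G partial_v_partial_v_ruled Q_def)
  \<comment> \<open>Here \<open>Q\<close> is \<open>E\<close> and \<open>G = 1\<close>; for the
    chosen direction the form equals \<open>E * (E * G - F\<^sup>2)\<close>, and
    \<open>E * G - F\<^sup>2 = w\<^sup>2\<close>.\<close>
  also have "Q * a\<^sup>2 + 2 * (d * l) * a * b + b\<^sup>2 = w\<^sup>2 * Q"
    unfolding w(2) assms(7,8) Q_def by (simp add: algebra_simps power2_eq_square)
  also have "- (k * v\<^sup>2 + d' * v + d\<^sup>2 * (k - l)) / w * a\<^sup>2 + 2 * (d / w) * a * b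
      = - d\<^sup>2 * l * ((k * l + 2) * v\<^sup>2 + l * d' * v + d\<^sup>2 * (k * l + l\<^sup>2 + 2)) / w"
    using w(1) unfolding assms(7,8) by (simp add: field_simps power2_eq_square)
  finally show "normal_curvature (ruled s e) u v a b =
      - d\<^sup>2 * l * ((k * l + 2) * v\<^sup>2 + l * d' * v + d\<^sup>2 * (k * l + l\<^sup>2 + 2))
        / (sqrt (v\<^sup>2 + d\<^sup>2) ^ 3 * (v\<^sup>2 + d\<^sup>2 * (l\<^sup>2 + 1)))"
    by (simp add: w_def Q_def power3_eq_cube power2_eq_square mult.assoc)
qed

section \<open>From single parameters to the whole interval\<close>

lemma continuous_on_conical_curvature:
  assumes S: "skew_ruled_C3_surface I s e"
  shows "continuous_on I (conical_curvature e)"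
proof -
  note reg = skew_ruled_regularity[OF S]
  have "continuous_on I e" "continuous_on I (D e)" "continuous_on I (D (D e))"
    by (auto intro!: differentiable_imp_continuous_on differentiable_at_imp_differentiable_on reg)
  then show ?thesis
    unfolding conical_curvature_def triple_def
    by (intro continuous_intros continuous_on_cross)
qed

unbundle no cross3_syntax

theorem proposition4:
  fixes I :: "real set" and s e :: "real \<Rightarrow> real ^ 3"
    and f :: "real \<Rightarrow> real" and n :: int
  assumes "skew_ruled_C3_surface I s e"
    and "continuous_on I f"
    and "\<forall>u\<in>I. \<forall>v a b. orth_traj_dir (ruled s e) u v a b \<longrightarrow>
           normal_curvature (ruled s e) u v a b
             = f u * sqrt (v\<^sup>2 + (distribution s e u)\<^sup>2) powi n"
  shows "((\<forall>u\<in>I. f u = 0) \<and> orthoid I s e) \<or>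
         (n = -3 \<and>
          (\<forall>u\<in>I. conical_curvature e u \<noteq> 0 \<and>
                 f u = (distribution s e u)\<^sup>2 * inverse (conical_curvature e u)) \<and>
          edlinger I s e)"
proof -
  note S = assms(1)
  let ?d = "distribution s e" and ?k = "conical_curvature e" and ?l = "cot_striction s e"
  have cases: "(f u = 0 \<and> ?l u = 0) \<or>
      (n = -3 \<and> (?d has_real_derivative 0) (at u) \<and> ?k u * ?l u + 1 = 0 \<and> f u * ?k u = (?d u)\<^sup>2)"
    and d_diff: "?d differentiable at u" and d0: "?d u \<noteq> 0" if u: "u \<in> I" for u
  proof -
    obtain d' where d': "(?d has_real_derivative d') (at u)"
      using has_derivative_distribution skew_ruled_regularity[OF S u] by blast
    then show "?d differentiable at u" using real_differentiable_def by blast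
    show d0: "?d u \<noteq> 0" using S u by (auto simp: skew_ruled_C3_surface_def)
    have "- (?d u)\<^sup>2 * ?l u * ((?k u * ?l u + 2) * v\<^sup>2 + ?l u * d' * v
          + (?d u)\<^sup>2 * (?k u * ?l u + (?l u)\<^sup>2 + 2))
        = f u * sqrt (v\<^sup>2 + (?d u)\<^sup>2) powi (n + 3) * (v\<^sup>2 + (?d u)\<^sup>2 * ((?l u)\<^sup>2 + 1))" for v
    proof -
      note N = normal_curvature_orth_traj[OF S u refl refl refl d' refl refl, of v]
      have E: "v\<^sup>2 + (?d u)\<^sup>2 * ((?l u)\<^sup>2 + 1) \<noteq> 0" and w: "sqrt (v\<^sup>2 + (?d u)\<^sup>2) \<noteq> 0"
        using d0 by (simp_all add: add_nonneg_pos less_imp_neq[symmetric])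
      from N assms(3) u
      have "- (?d u)\<^sup>2 * ?l u * ((?k u * ?l u + 2) * v\<^sup>2 + ?l u * d' * v
            + (?d u)\<^sup>2 * (?k u * ?l u + (?l u)\<^sup>2 + 2))
          / (sqrt (v\<^sup>2 + (?d u)\<^sup>2) ^ 3 * (v\<^sup>2 + (?d u)\<^sup>2 * ((?l u)\<^sup>2 + 1)))
          = f u * sqrt (v\<^sup>2 + (?d u)\<^sup>2) powi n" (is "?p / (?w ^ 3 * ?E) = _") by metis
      \<comment> \<open>Clearing the denominator contributes the 3 in the exponent
        \<open>n + 3\<close>.\<close>
      then have "?p = f u * ?w powi n * (?w ^ 3 * ?E)"
        using E w by (metis divide_eq_eq mult_eq_0_iff power_not_zero)
      moreover have "?w powi (n + 3) = ?w powi n * ?w ^ 3"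
        using w by (simp only: power_int_add power_int_numeral simp_thms)
      ultimately show ?thesis
        by (simp only: mult.assoc)
    qed
    from normal_curvature_identity_cases[OF this d0] d'
    show "(f u = 0 \<and> ?l u = 0) \<or>
      (n = -3 \<and> (?d has_real_derivative 0) (at u) \<and> ?k u * ?l u + 1 = 0 \<and> f u * ?k u = (?d u)\<^sup>2)"
      by auto
  qed
  have "continuous_on I ?d"
    by (intro differentiable_imp_continuous_on differentiable_at_imp_differentiable_on d_diff)
  then have "continuous_on I (\<lambda>u. f u * ?k u - (?d u)\<^sup>2)"
    using assms(2) continuous_on_conical_curvature[OF S] by (intro continuous_intros)
  then have "closedin (top_of_set I) {u \<in> I. f u * ?k u - (?d u)\<^sup>2 = 0}"
    and "closedin (top_of_set I) {u \<in> I. f u = 0}"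
    using assms(2) by (simp_all only: continuous_closedin_preimage_constant)
  moreover have "connected I"
    using S is_interval_connected by (auto simp: skew_ruled_C3_surface_def)
  moreover have "{u \<in> I. f u * ?k u - (?d u)\<^sup>2 = 0} \<inter> {u \<in> I. f u = 0} = {}"
    using d0 by auto
  moreover have "I \<subseteq> {u \<in> I. f u * ?k u - (?d u)\<^sup>2 = 0} \<union> {u \<in> I. f u = 0}"
    using cases by auto
  ultimately have "{u \<in> I. f u * ?k u - (?d u)\<^sup>2 = 0} = {} \<or> {u \<in> I. f u = 0} = {}"
    unfolding connected_closedin by blast
  \<comment> \<open>An empty \<open>I\<close> falls under the first case. In the second,
    \<open>I \<noteq> {}\<close> supplies the parameter from which \<open>n = -3\<close>, a
    statement free of \<open>u\<close>, is read off.\<close>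
  then consider "\<forall>u\<in>I. f u = 0" | "\<forall>u\<in>I. f u \<noteq> 0" "I \<noteq> {}"
    using cases by auto
  then show ?thesis
  proof cases
    case 1
    \<comment> \<open>With \<open>f u = 0\<close> the other alternative would make \<delta> vanish
      at \<open>u\<close>.\<close>
    then have "?l u = 0" if "u \<in> I" for u using cases[OF that] d0[OF that] that by auto
    then show ?thesis using 1 by (simp add: orthoid_def)
  next
    case 2
    have *: "n = -3 \<and> (?d has_real_derivative 0) (at u) \<and> ?k u * ?l u + 1 = 0
        \<and> f u * ?k u = (?d u)\<^sup>2" if "u \<in> I" for u
      using 2(1) cases[OF that] that by auto
    have "?k u \<noteq> 0 \<and> f u = (?d u)\<^sup>2 * inverse (?k u)" if "u \<in> I" for u
    proof -
      have "?k u \<noteq> 0" using *[OF that] by auto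
      then show ?thesis using *[OF that] by (simp add: field_simps)
    qed
    then show ?thesis using * 2(2) S by (auto simp: edlinger_def)
  qed
qed

end
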